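(* (i) For every integer $n\ge 5$, $o_E(\Lambda_n) = o_V(\Gamma_{n-3})$. (ii) For every positive integer $n$, \[ o_E(\Lambda_n) = \frac{1}{2}\left(F_{n-1} + F_{\lfloor \frac{n+1+(-1)^n}{2}\rfloor}\right). \]
   Context: A Fibonacci string is a binary string with no two consecutive 1s; the Fibonacci cube $\Gamma_m$ is the subgraph of the $m$-cube $Q_m$ (binary strings of length $m$, adjacent iff they differ in exactly one position) induced by the Fibonacci strings of length $m$. A Lucas string of length $n$ is a Fibonacci string $u_1\cdots u_n$ that does not have both $u_1=1$ and $u_n=1$; the Lucas cube $\Lambda_n$ is the subgraph of $Q_n$ induced by the Lucas strings of length $n$. For a graph $G$, $o_V(G)$ is the number of orbits of the automorphism group ${\rm Aut}(G)$ acting on $V(G)$, and $o_E(G)$ is the number of orbits of ${\rm Aut}(G)$ acting on $E(G)$ via $\{u,v\}\mapsto\{g(u),g(v)\}$. $F_m$ are Fibonacci numbers with $F_0=0$, $F_1=1$. *)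

theory Defs
  imports "HOL-Algebra.Group_Action" "HOL-Number_Theory.Fib"
begin

section \<open>Simple graphs and orbits of their automorphism groups\<close>

text \<open>The intended edge sets consist of two-element subsets of the vertex set.\<close>

record 'a ugraph =
  uverts :: "'a set"
  uedges :: "'a set set"

definition simple_ugraph :: "'a ugraph \<Rightarrow> bool" where
  "simple_ugraph G \<longleftrightarrow> (\<forall>e\<in>uedges G. e \<subseteq> uverts G \<and> card e = 2)"

definition induced_ugraph :: "'a ugraph \<Rightarrow> 'a set \<Rightarrow> 'a ugraph" where
  "induced_ugraph G W = \<lparr>uverts = uverts G \<inter> W, uedges = {e \<in> uedges G. e \<subseteq> W}\<rparr>"

text \<open>As for \<^const>\<open>BijGroup\<close>, automorphisms are extensional, so that distinct functions
  agreeing on the vertex set are not counted as distinct automorphisms.\<close>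

definition ugraph_auts :: "'a ugraph \<Rightarrow> ('a \<Rightarrow> 'a) set" where
  "ugraph_auts G = {g \<in> Bij (uverts G).
     \<forall>u\<in>uverts G. \<forall>v\<in>uverts G. {u, v} \<in> uedges G \<longleftrightarrow> {g u, g v} \<in> uedges G}"

definition ugraph_Aut :: "'a ugraph \<Rightarrow> ('a \<Rightarrow> 'a) monoid" where
  "ugraph_Aut G = BijGroup (uverts G) \<lparr>carrier := ugraph_auts G\<rparr>"

definition vertex_orbits :: "'a ugraph \<Rightarrow> 'a set set" where
  "vertex_orbits G = orbits (ugraph_Aut G) (uverts G) (\<lambda>g. g)"

definition edge_orbits :: "'a ugraph \<Rightarrow> 'a set set set" where
  "edge_orbits G = orbits (ugraph_Aut G) (uedges G) (\<lambda>g. \<lambda>e\<in>uedges G. g ` e)"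

definition o_V :: "'a ugraph \<Rightarrow> nat" where
  "o_V G = card (vertex_orbits G)"

definition o_E :: "'a ugraph \<Rightarrow> nat" where
  "o_E G = card (edge_orbits G)"

section \<open>Fibonacci cubes and Lucas cubes\<close>

text \<open>Binary strings are Boolean lists, with \<^const>\<open>True\<close> for 1; positions start at 0.\<close>

definition hypercube :: "nat \<Rightarrow> bool list ugraph" where
  "hypercube n =
     \<lparr>uverts = {u. length u = n},
      uedges = {{u, v} | u v. length u = n \<and> length v = n \<and> (\<exists>!i. i < n \<and> u ! i \<noteq> v ! i)}\<rparr>"

definition fibonacci_string :: "bool list \<Rightarrow> bool" where
  "fibonacci_string u \<longleftrightarrow> (\<forall>i. Suc i < length u \<longrightarrow> \<not> (u ! i \<and> u ! Suc i))"

text \<open>In a string of length 1 the first and the last position coincide, so that the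
  string 1 is not a Lucas string.\<close>

definition lucas_string :: "bool list \<Rightarrow> bool" where
  "lucas_string u \<longleftrightarrow> fibonacci_string u \<and> \<not> (u \<noteq> [] \<and> hd u \<and> last u)"

definition fibonacci_cube :: "nat \<Rightarrow> bool list ugraph" where
  "fibonacci_cube m = induced_ugraph (hypercube m) {u. fibonacci_string u}"

definition lucas_cube :: "nat \<Rightarrow> bool list ugraph" where
  "lucas_cube n = induced_ugraph (hypercube n) {u. lucas_string u}"

section \<open>Well-definedness\<close>

lemma simple_hypercube: "simple_ugraph (hypercube n)"
  by (fastforce simp: simple_ugraph_def hypercube_def card_2_iff)

lemma simple_induced: "simple_ugraph G \<Longrightarrow> simple_ugraph (induced_ugraph G W)"
  by (auto simp: simple_ugraph_def induced_ugraph_def)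

lemma ugraph_auts_subgroup: "subgroup (ugraph_auts G) (BijGroup (uverts G))"
proof -
  interpret B: group "BijGroup (uverts G)" by (rule group_BijGroup)
  show ?thesis
  proof (rule B.subgroupI)
    show "ugraph_auts G \<subseteq> carrier (BijGroup (uverts G))"
      by (auto simp: ugraph_auts_def BijGroup_def)
    have "(\<lambda>x\<in>uverts G. x) \<in> ugraph_auts G"
      by (auto simp: ugraph_auts_def id_Bij)
    then show "ugraph_auts G \<noteq> {}" by blast
  next
    fix g assume g: "g \<in> ugraph_auts G"
    then have gB: "g \<in> Bij (uverts G)" by (simp add: ugraph_auts_def)
    then have bij: "bij_betw g (uverts G) (uverts G)" by (simp add: Bij_def)
    have "{u, v} \<in> uedges G \<longleftrightarrow>
        {inv_into (uverts G) g u, inv_into (uverts G) g v} \<in> uedges G"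
      if "u \<in> uverts G" "v \<in> uverts G" for u v
      using g that Bij_inv_into_mem[OF gB] bij_betw_inv_into_right[OF bij]
      by (force simp: ugraph_auts_def)
    then show "inv\<^bsub>BijGroup (uverts G)\<^esub> g \<in> ugraph_auts G"
      using gB by (auto simp: inv_BijGroup ugraph_auts_def restrict_inv_into_Bij)
  next
    fix g h assume gh: "g \<in> ugraph_auts G" "h \<in> ugraph_auts G"
    then have B: "g \<in> Bij (uverts G)" "h \<in> Bij (uverts G)" by (simp_all add: ugraph_auts_def)
    have "h u \<in> uverts G" if "u \<in> uverts G" for u
      using Bij_imp_funcset[OF B(2)] that by auto
    then show "g \<otimes>\<^bsub>BijGroup (uverts G)\<^esub> h \<in> ugraph_auts G"
      using gh B by (auto simp: BijGroup_def ugraph_auts_def compose_Bij compose_eq)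
  qed
qed

lemma group_ugraph_Aut: "group (ugraph_Aut G)"
  unfolding ugraph_Aut_def
  by (rule subgroup.subgroup_is_group[OF ugraph_auts_subgroup group_BijGroup])

lemma vertex_group_action: "group_action (ugraph_Aut G) (uverts G) (\<lambda>g. g)"
proof -
  have "(\<lambda>g. g) \<in> hom (ugraph_Aut G) (BijGroup (uverts G))"
    by (auto simp: hom_def ugraph_Aut_def BijGroup_def ugraph_auts_def)
  then show ?thesis
    by (simp add: group_action_def group_hom_def group_hom_axioms_def group_ugraph_Aut
        group_BijGroup)
qed

lemma edge_group_action:
  assumes "simple_ugraph G"
  shows "group_action (ugraph_Aut G) (uedges G) (\<lambda>g. \<lambda>e\<in>uedges G. g ` e)"
proof -
  have sub: "e \<subseteq> uverts G" if "e \<in> uedges G" for e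
    using assms that by (auto simp: simple_ugraph_def)
  have edge: "\<exists>u v. e = {u, v} \<and> u \<in> uverts G \<and> v \<in> uverts G" if "e \<in> uedges G" for e
    using assms that by (fastforce simp: simple_ugraph_def card_2_iff)
  have B: "g \<in> Bij (uverts G)" if "g \<in> ugraph_auts G" for g
    using that by (simp add: ugraph_auts_def)
  have img: "g ` e \<in> uedges G" if g: "g \<in> ugraph_auts G" and "e \<in> uedges G" for g e
    using g edge[OF that(2)] that(2) by (auto simp: ugraph_auts_def)
  have Bij: "(\<lambda>e\<in>uedges G. g ` e) \<in> Bij (uedges G)" if g: "g \<in> ugraph_auts G" for g
  proof -
    have bij: "bij_betw g (uverts G) (uverts G)" using B[OF g] by (simp add: Bij_def)
    have inj: "inj_on (image g) (uedges G)"
      using inj_on_image_Pow[of g "uverts G"] bij sub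
      by (auto simp: bij_betw_def intro: inj_on_subset)
    have "e \<in> image g ` uedges G" if e: "e \<in> uedges G" for e
    proof -
      obtain u v where uv: "e = {u, v}" "u \<in> uverts G" "v \<in> uverts G" using edge[OF e] by blast
      then obtain u' v' where "u' \<in> uverts G" "v' \<in> uverts G" "u = g u'" "v = g v'"
        using bij by (metis bij_betw_def imageE)
      moreover from this have "{u', v'} \<in> uedges G"
        using g e uv by (auto simp: ugraph_auts_def)
      ultimately show ?thesis using uv by (intro image_eqI[of _ _ "{u', v'}"]) auto
    qed
    then have "image g ` uedges G = uedges G" using img[OF g] by blast
    with inj show ?thesis by (simp add: Bij_def bij_betw_def cong: inj_on_cong)
  qed
  have comp: "compose (uverts G) g h ` e = g ` h ` e" if "e \<in> uedges G" for g h e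
  proof -
    have "compose (uverts G) g h ` e = (\<lambda>x. g (h x)) ` e"
      using sub[OF that] by (intro image_cong) (auto simp: compose_def)
    then show ?thesis by (simp add: image_image)
  qed
  have "(\<lambda>e\<in>uedges G. compose (uverts G) g h ` e) =
      compose (uedges G) (\<lambda>e\<in>uedges G. g ` e) (\<lambda>e\<in>uedges G. h ` e)"
    if "h \<in> ugraph_auts G" for g h
  proof
    show "(\<lambda>e\<in>uedges G. compose (uverts G) g h ` e) e =
        compose (uedges G) (\<lambda>e\<in>uedges G. g ` e) (\<lambda>e\<in>uedges G. h ` e) e" for e
      using img[OF that, of e] comp[of e g h] by (cases "e \<in> uedges G") (simp_all add: compose_def)
  qed
  then have "(\<lambda>g. \<lambda>e\<in>uedges G. g ` e) \<in> hom (ugraph_Aut G) (BijGroup (uedges G))"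
    using Bij B by (auto simp: hom_def ugraph_Aut_def BijGroup_def)
  then show ?thesis
    by (simp add: group_action_def group_hom_def group_hom_axioms_def group_ugraph_Aut
        group_BijGroup)
qed

end

theory Submission
  imports Defs "HOL-Number_Theory.Cong"
begin

text \<open>Read a string as its set of positions with letter 1. Fibonacci and Lucas strings are then
  the independent sets of a path and of a cycle, and if that graph has no isolated vertex, every
  automorphism of the cube is induced by one of the path or cycle, that is, by a reflection or a
  dihedral symmetry.
  So the vertex orbits of the Fibonacci cube are the classes of strings up to reversal, while
  rotating the changed position of an edge of the Lucas cube to the front leaves a Fibonacci string
  with three letters fewer, determined up to reversal. The number of reversal classes follows from
  counting Fibonacci strings and palindromic Fibonacci strings.\<close>

section \<open>Automorphisms of simplicial families of sets\<close>

text \<open>The changed position of a Lucas edge forces 0 at both its neighbours on the cycle, and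
  the other \<open>n - 3\<close> positions form a path; hence the shift by three. Besides the
  identity, only the reflection through the changed position fixes it, and that reflection reverses
  the path. An isolated vertex would split off a factor with two vertices from the cube, and
  exchanging these two is not a permutation of positions. This happens for the path with one vertex:
  its cube has a single vertex orbit, while the Lucas cube of length 4 has two edge orbits. So (i)
  fails at n = 4 and the argument for vertices needs n - 3 >= 2. The edges involve only
  automorphisms coming from the cycle, so their orbits are counted for all n >= 3. For this reason
  both sides of (i) are compared with \<open>reversal_classes\<close> instead of with each other,
  and (ii) does not pass through (i).\<close>

definition set_adj :: "'a set \<Rightarrow> 'a set \<Rightarrow> bool" where
  "set_adj A B \<longleftrightarrow> (\<exists>x. sym_diff A B = {x})"

definition toggle :: "'a \<Rightarrow> 'a set \<Rightarrow> 'a set" where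
  "toggle x A = (if x \<in> A then A - {x} else insert x A)"

lemma mem_toggle: "y \<in> toggle x A \<longleftrightarrow> (y \<in> A) \<noteq> (y = x)"
  by (auto simp: toggle_def)

lemma set_adj_iff_toggle: "set_adj A B \<longleftrightarrow> (\<exists>x. B = toggle x A)"
proof -
  have "sym_diff A B = {x} \<longleftrightarrow> B = toggle x A" for x
    unfolding set_eq_iff mem_toggle by blast
  then show ?thesis by (simp add: set_adj_def)
qed

lemma toggle_inject: "toggle x A = toggle y A \<Longrightarrow> x = y"
  unfolding toggle_def by (auto split: if_splits)

lemma toggle_empty [simp]: "toggle x {} = {x}"
  by (simp add: toggle_def)

text \<open>The two deletions differ exactly at \<open>a\<close> and \<open>b\<close>, so a common
  neighbour arises from each by toggling one of these two. The four sets form a square of the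
  hypercube.\<close>

lemma set_adj_two_deletions:
  assumes "set_adj (A - {a}) X" "set_adj (A - {b}) X" "a \<in> A" "b \<in> A" "a \<noteq> b"
  shows "X = A \<or> X = A - {a} - {b}"
proof -
  obtain x y where x: "X = toggle x (A - {a})" and y: "X = toggle y (A - {b})"
    using assms by (auto simp: set_adj_iff_toggle)
  have "x = a \<or> x = b"
    using x y assms(3-5) by (metis DiffE DiffI insertI1 mem_toggle singletonD)
  then show ?thesis using x assms by (auto simp: toggle_def)
qed

text \<open>The last assumption singles out the empty set: a nonempty set to which every further
  element could be added would have the same degree. For independent sets of a graph it follows from
  the absence of isolated vertices.\<close>

context
  fixes V :: "'a set" and F :: "'a set set"
  assumes finite_V: "finite V"
    and F_subset: "\<And>S. S \<in> F \<Longrightarrow> S \<subseteq> V"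
    and F_down: "\<And>S T. S \<in> F \<Longrightarrow> T \<subseteq> S \<Longrightarrow> T \<in> F"
    and F_empty: "{} \<in> F"
    and F_single: "\<And>v. v \<in> V \<Longrightarrow> {v} \<in> F"
    and F_no_cone: "\<And>S. S \<in> F \<Longrightarrow> S \<noteq> {} \<Longrightarrow> \<exists>x\<in>V - S. insert x S \<notin> F"
begin

lemma set_neighbours:
  assumes "S \<in> F"
  shows "{T \<in> F. set_adj S T} = (\<lambda>x. toggle x S) ` {x \<in> V. toggle x S \<in> F}"
proof -
  have "x \<in> V" if "toggle x S \<in> F" for x
    using F_subset[OF that] F_subset[OF assms] by (auto simp: toggle_def split: if_splits)
  then show ?thesis by (auto simp: set_adj_iff_toggle)
qed

text \<open>Neighbours of \<open>S\<close> correspond to the elements that may be toggled, and full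
  degree means that all may. Removal is always possible, so the condition concerns only insertions,
  which \<open>F_no_cone\<close> blocks somewhere unless \<open>S\<close> is empty.\<close>

lemma card_set_neighbours:
  assumes "S \<in> F"
  shows "card {T \<in> F. set_adj S T} = card V \<longleftrightarrow> S = {}"
proof -
  have card: "card {T \<in> F. set_adj S T} = card {x \<in> V. toggle x S \<in> F}"
    unfolding set_neighbours[OF assms] by (intro card_image inj_onI) (rule toggle_inject)
  show ?thesis
  proof
    assume eq: "card {T \<in> F. set_adj S T} = card V"
    have all: "{x \<in> V. toggle x S \<in> F} = V"
      by (rule card_subset_eq) (use finite_V card eq in auto)
    show "S = {}"
    proof (rule ccontr)
      assume "S \<noteq> {}"
      then obtain x where x: "x \<in> V - S" "insert x S \<notin> F" using F_no_cone[OF assms] by blast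
      then have "toggle x S \<in> F" using all by blast
      then show False using x by (simp add: toggle_def)
    qed
  next
    assume S: "S = {}"
    have "{x \<in> V. toggle x S \<in> F} = V" using F_single by (auto simp: S)
    then show "card {T \<in> F. set_adj S T} = card V" using card by simp
  qed
qed

text \<open>The empty set is the only vertex of degree \<^term>\<open>card V\<close>, so it is fixed; on
  singletons the automorphism is a permutation, which determines it everywhere because the
  vertices \<^term>\<open>S - {i}\<close> and \<^term>\<open>S - {j}\<close> have only one other common neighbour.\<close>

lemma simplicial_aut_induced:
  assumes bij: "bij_betw g F F"
    and adj: "\<And>S T. S \<in> F \<Longrightarrow> T \<in> F \<Longrightarrow> set_adj (g S) (g T) \<longleftrightarrow> set_adj S T"
  shows "\<exists>\<pi>. inj_on \<pi> V \<and> \<pi> ` V \<subseteq> V \<and> (\<forall>S\<in>F. g S = \<pi> ` S)"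
proof -
  have gF: "g S \<in> F" if "S \<in> F" for S using bij that by (auto simp: bij_betw_def)
  have inj: "S = T" if "S \<in> F" "T \<in> F" "g S = g T" for S T
    using bij that by (auto simp: bij_betw_def inj_on_def)
  \<comment> \<open>Surjectivity makes \<open>g\<close> map the neighbourhood of the empty set onto
    that of its image, so the two degrees agree.\<close>
  have "T \<in> g ` {T \<in> F. set_adj {} T}" if "T \<in> F" "set_adj (g {}) T" for T
  proof -
    have "T \<in> g ` F" using bij_betw_imp_surj_on[OF bij] that(1) by simp
    then obtain S where "S \<in> F" "T = g S" by blast
    then show ?thesis using adj[OF F_empty] that(2) by blast
  qed
  then have img: "g ` {T \<in> F. set_adj {} T} = {T \<in> F. set_adj (g {}) T}"
    using gF adj[OF F_empty] by auto
  have "inj_on g {T \<in> F. set_adj {} T}"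
    using inj by (auto simp: inj_on_def)
  from card_image[OF this]
  have "card {T \<in> F. set_adj (g {}) T} = card {T \<in> F. set_adj {} T}"
    by (simp add: img)
  then have g0: "g {} = {}"
    using card_set_neighbours[OF F_empty] card_set_neighbours[OF gF[OF F_empty]] by simp
  have "\<exists>w. g {v} = {w}" if "v \<in> V" for v
  proof -
    have "set_adj {} {v}" by (auto simp: set_adj_iff_toggle)
    then have "set_adj {} (g {v})"
      using adj[OF F_empty F_single[OF that]] by (simp add: g0)
    then show ?thesis by (auto simp: set_adj_iff_toggle)
  qed
  then obtain \<pi> where \<pi>: "\<And>v. v \<in> V \<Longrightarrow> g {v} = {\<pi> v}" by metis
  have \<pi>V: "\<pi> ` V \<subseteq> V"
    using \<pi> gF F_subset F_single by fastforce
  have \<pi>inj: "inj_on \<pi> V"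
    using \<pi> inj F_single by (metis inj_onI singleton_inject)
  have "g S = \<pi> ` S" if "S \<in> F" for S
    using finite_subset[OF F_subset[OF that] finite_V] that
  proof (induction S rule: finite_psubset_induct)
    case (psubset S)
    have SV: "S \<subseteq> V" using psubset.prems by (rule F_subset)
    have IH: "g T = \<pi> ` T" if "T \<subset> S" for T
      using psubset.IH[OF that] F_down[OF psubset.prems] that by blast
    have del: "g (S - A) = \<pi> ` S - \<pi> ` A" if "A \<subseteq> S" "A \<noteq> {}" for A
    proof -
      have "S - A \<subset> S" using that by blast
      then have "g (S - A) = \<pi> ` (S - A)" by (rule IH)
      also have "\<dots> = \<pi> ` S - \<pi> ` A"
        by (rule inj_on_image_set_diff[OF \<pi>inj]) (use SV that in auto)
      finally show ?thesis .
    qed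
    consider "S = {}" | v where "S = {v}" | v w where "v \<in> S" "w \<in> S" "v \<noteq> w" by blast
    then show ?case
    proof cases
      case 1 then show ?thesis by (simp add: g0)
    next
      case 2 then show ?thesis using \<pi> SV by simp
    next
      case 3
      have near: "set_adj (\<pi> ` S - {\<pi> x}) (g S)" if "x \<in> S" for x
      proof -
        have "set_adj (S - {x}) S" using that by (auto simp: set_adj_def)
        moreover have "S - {x} \<in> F" using F_down[OF psubset.prems] by blast
        ultimately have "set_adj (g (S - {x})) (g S)" using adj psubset.prems by blast
        then show ?thesis using del[of "{x}"] that by simp
      qed
      have ne: "\<pi> v \<noteq> \<pi> w" using 3 \<pi>inj SV by (auto simp: inj_on_def)
      have "g S = \<pi> ` S \<or> g S = \<pi> ` S - {\<pi> v} - {\<pi> w}"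
        using set_adj_two_deletions[OF near near, of v w] 3 ne by auto
      \<comment> \<open>The other corner of the square is already the image of
        \<open>S - {v, w}\<close>, so injectivity of \<open>g\<close> excludes it.\<close>
      moreover have "g S \<noteq> \<pi> ` S - {\<pi> v} - {\<pi> w}"
      proof
        assume "g S = \<pi> ` S - {\<pi> v} - {\<pi> w}"
        moreover have "\<pi> ` S - {\<pi> v} - {\<pi> w} = g (S - {v, w})"
          using del[of "{v, w}"] 3 by auto
        ultimately have "S = S - {v, w}"
          using inj[of S "S - {v, w}"] psubset.prems F_down[OF psubset.prems] by auto
        then show False using 3 by blast
      qed
      ultimately show ?thesis by blast
    qed
  qed
  with \<pi>inj \<pi>V show ?thesis by (intro exI[of _ \<pi>] conjI ballI)
qed

end

section \<open>Dihedral symmetries of paths and cycles\<close>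

text \<open>Two successive steps of opposite sign would bring \<open>p\<close> back to the same
  value modulo \<open>N\<close>, so every step has the sign of the first. Since divisibility by 0 is
  equality to 0, the choice \<open>N = 0\<close> covers paths and \<open>N = n\<close> covers
  cycles.\<close>

lemma int_steps_monotone:
  fixes p :: "nat \<Rightarrow> int"
  assumes step: "\<And>i. Suc i < m \<Longrightarrow> N dvd p (Suc i) - p i - 1 \<or> N dvd p (Suc i) - p i + 1"
    and nonrev: "\<And>i. Suc (Suc i) < m \<Longrightarrow> \<not> N dvd p (Suc (Suc i)) - p i"
  shows "(\<forall>i<m. N dvd p i - p 0 - int i) \<or> (\<forall>i<m. N dvd p i - p 0 + int i)"
proof (cases "1 < m")
  case False
  then show ?thesis by (cases m) auto
next
  case True
  have *: "\<forall>i. Suc i < m \<longrightarrow> N dvd p (Suc i) - p i - d"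
    if d: "d = 1 \<or> d = -1" and base: "N dvd p 1 - p 0 - d" for d :: int
  proof (intro allI impI)
    fix i assume "Suc i < m"
    then show "N dvd p (Suc i) - p i - d"
    proof (induction i)
      case 0 then show ?case using base by simp
    next
      case (Suc i)
      have "\<not> N dvd p (Suc (Suc i)) - p (Suc i) + d"
      proof
        assume "N dvd p (Suc (Suc i)) - p (Suc i) + d"
        with Suc have "N dvd (p (Suc (Suc i)) - p (Suc i) + d) + (p (Suc i) - p i - d)"
          by (intro dvd_add[of N _ "p (Suc i) - p i - d"]) auto
        then show False using nonrev[of i] Suc.prems by simp
      qed
      then show ?case using step[of "Suc i"] Suc.prems d by auto
    qed
  qed
  have sum: "N dvd p i - p 0 - d * int i"
    if "\<forall>i. Suc i < m \<longrightarrow> N dvd p (Suc i) - p i - d" "i < m" for d i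
    using that(2)
  proof (induction i)
    case (Suc i)
    then have "N dvd (p (Suc i) - p i - d) + (p i - p 0 - d * int i)"
      using that(1) by (intro dvd_add[of N _ "p i - p 0 - d * int i"]) auto
    then show ?case by (simp add: algebra_simps)
  qed simp
  have "N dvd p 1 - p 0 - 1 \<or> N dvd p 1 - p 0 - (-1)" using step[of 0] True by simp
  then show ?thesis using *[of 1] *[of "-1"] sum[of 1] sum[of "-1"] by auto
qed

text \<open>Injectivity forbids turning back, so the walk is monotone. A monotone walk through
  \<open>m\<close> positions inside \<open>{..<m}\<close> has to start at one of the two
  ends.\<close>

lemma path_embedding:
  fixes \<pi> :: "nat \<Rightarrow> nat"
  assumes inj: "inj_on \<pi> {..<m}" and range: "\<pi> ` {..<m} \<subseteq> {..<m}"
    and step: "\<And>i. Suc i < m \<Longrightarrow> \<pi> (Suc i) = Suc (\<pi> i) \<or> \<pi> i = Suc (\<pi> (Suc i))"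
  shows "(\<forall>i<m. \<pi> i = i) \<or> (\<forall>i<m. \<pi> i = m - 1 - i)"
proof (cases "m = 0")
  case False
  have "\<pi> (Suc (Suc i)) \<noteq> \<pi> i" if "Suc (Suc i) < m" for i
    using inj_onD[OF inj, of "Suc (Suc i)" i] that by auto
  then have "(\<forall>i<m. 0 dvd int (\<pi> i) - int (\<pi> 0) - int i) \<or> (\<forall>i<m. 0 dvd int (\<pi> i) - int (\<pi> 0) + int i)"
    by (intro int_steps_monotone) (use step in force)+
  then consider "\<And>i. i < m \<Longrightarrow> \<pi> i = \<pi> 0 + i" | "\<And>i. i < m \<Longrightarrow> \<pi> i + i = \<pi> 0"
    by fastforce
  then show ?thesis
  proof cases
    case 1
    have "\<pi> (m - 1) = \<pi> 0 + (m - 1)" using 1[of "m - 1"] False by linarith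
    moreover have "\<pi> (m - 1) < m" using range False by (simp add: image_subset_iff)
    ultimately have "\<pi> 0 = 0" by linarith
    then have "\<forall>i<m. \<pi> i = i" using 1 by (metis add_0)
    then show ?thesis ..
  next
    case 2
    have "\<pi> (m - 1) + (m - 1) = \<pi> 0" using 2[of "m - 1"] False by linarith
    moreover have "\<pi> 0 < m" using range False by auto
    ultimately have "\<pi> 0 = m - 1" by linarith
    then have "\<forall>i<m. \<pi> i = m - 1 - i" using 2 by (metis diff_add_inverse2)
    then show ?thesis ..
  qed
qed simp

text \<open>Here the walk is monotone modulo \<open>n\<close> and may start anywhere. The term
  \<open>n - i\<close> represents the residue of \<open>- i\<close> without truncated
  subtraction.\<close>

lemma cycle_embedding:
  fixes \<pi> :: "nat \<Rightarrow> nat"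
  assumes inj: "inj_on \<pi> {..<n}" and range: "\<pi> ` {..<n} \<subseteq> {..<n}"
    and step: "\<And>i. Suc i < n \<Longrightarrow> \<pi> (Suc i) = Suc (\<pi> i) mod n \<or> \<pi> i = Suc (\<pi> (Suc i)) mod n"
  shows "(\<forall>i<n. \<pi> i = (\<pi> 0 + i) mod n) \<or> (\<forall>i<n. \<pi> i = (\<pi> 0 + (n - i)) mod n)"
proof -
  have lt: "\<pi> i < n" if "i < n" for i using range that by auto
  have mod_eq: "a = b mod n \<longleftrightarrow> int n dvd int a - int b" if "a < n" for a b
    using that by (metis mod_eq_dvd_iff mod_less of_nat_eq_iff zmod_int)
  have "(\<forall>i<n. int n dvd int (\<pi> i) - int (\<pi> 0) - int i) \<or>
      (\<forall>i<n. int n dvd int (\<pi> i) - int (\<pi> 0) + int i)"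
  proof (rule int_steps_monotone)
    fix i assume i: "Suc i < n"
    have "int n dvd int (\<pi> i) - int (\<pi> (Suc i)) - 1 \<longleftrightarrow> int n dvd int (\<pi> (Suc i)) - int (\<pi> i) + 1"
      by (subst dvd_minus_iff[symmetric]) (simp add: algebra_simps)
    then show "int n dvd int (\<pi> (Suc i)) - int (\<pi> i) - 1 \<or> int n dvd int (\<pi> (Suc i)) - int (\<pi> i) + 1"
      using step[OF i] lt i by (auto simp: mod_eq algebra_simps)
  next
    fix i assume i: "Suc (Suc i) < n"
    have "\<pi> (Suc (Suc i)) \<noteq> \<pi> i" using inj_onD[OF inj, of "Suc (Suc i)" i] i by auto
    then show "\<not> int n dvd int (\<pi> (Suc (Suc i))) - int (\<pi> i)"
      using mod_eq[of "\<pi> (Suc (Suc i))" "\<pi> i"] lt i by simp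
  qed
  moreover have "int n dvd int a - int b + int i \<longleftrightarrow> int n dvd int a - int (b + (n - i))"
    if "i < n" for a b i
  proof -
    have "int a - int b + int i = int a - int (b + (n - i)) + int n" using that by simp
    then show ?thesis by (metis dvd_add_left_iff dvd_refl)
  qed
  ultimately show ?thesis using lt by (auto simp: mod_eq algebra_simps)
qed

section \<open>Induced subgraphs of hypercubes\<close>

definition ones :: "bool list \<Rightarrow> nat set" where
  "ones u = {i. i < length u \<and> u ! i}"

definition bits :: "nat \<Rightarrow> nat set \<Rightarrow> bool list" where
  "bits n S = map (\<lambda>i. i \<in> S) [0..<n]"

lemma length_bits [simp]: "length (bits n S) = n"
  by (simp add: bits_def)

lemma nth_bits [simp]: "i < n \<Longrightarrow> bits n S ! i \<longleftrightarrow> i \<in> S"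
  by (simp add: bits_def)

lemma ones_bits: "S \<subseteq> {..<n} \<Longrightarrow> ones (bits n S) = S"
  by (auto simp: ones_def)

lemma ones_subset: "ones u \<subseteq> {..<length u}"
  by (auto simp: ones_def)

lemma bits_ones: "bits (length u) (ones u) = u"
  by (rule nth_equalityI) (auto simp: ones_def)

lemma ones_inject: "length u = length v \<Longrightarrow> ones u = ones v \<Longrightarrow> u = v"
  by (metis bits_ones)

abbreviation cube :: "nat \<Rightarrow> bool list set \<Rightarrow> bool list ugraph" where
  "cube n W \<equiv> induced_ugraph (hypercube n) W"

lemma uverts_cube: "uverts (cube n W) = {u \<in> W. length u = n}"
  by (auto simp: induced_ugraph_def hypercube_def)

lemma unique_difference_iff:
  assumes "length u = n" "length v = n"
  shows "(\<exists>!i. i < n \<and> u ! i \<noteq> v ! i) \<longleftrightarrow> set_adj (ones u) (ones v)"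
proof -
  have "i \<in> sym_diff (ones u) (ones v) \<longleftrightarrow> i < n \<and> u ! i \<noteq> v ! i" for i
    using assms by (auto simp: ones_def)
  then show ?thesis
    unfolding set_adj_def set_eq_iff singleton_iff by (metis (no_types, lifting))
qed

lemma edge_cube_iff:
  assumes "u \<in> uverts (cube n W)" "v \<in> uverts (cube n W)"
  shows "{u, v} \<in> uedges (cube n W) \<longleftrightarrow> set_adj (ones u) (ones v)"
proof -
  have uv: "length u = n" "length v = n" "u \<in> W" "v \<in> W" using assms by (auto simp: uverts_cube)
  let ?D = "\<lambda>a b. \<exists>!i. i < n \<and> a ! i \<noteq> b ! i"
  have "{u, v} \<in> uedges (cube n W) \<longleftrightarrow> ?D u v \<or> ?D v u"
  proof -
    have doubleton: "(\<exists>a b. {u, v} = {a, b} \<and> P a b) \<longleftrightarrow> P u v \<or> P v u" for P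
      unfolding doubleton_eq_iff by blast
    have "{u, v} \<in> uedges (cube n W) \<longleftrightarrow>
        (\<exists>a b. {u, v} = {a, b} \<and> length a = n \<and> length b = n \<and> ?D a b)"
      using uv(3,4) by (simp add: induced_ugraph_def hypercube_def)
    then show ?thesis using uv(1,2) by (simp only: doubleton) simp
  qed
  also have "\<dots> \<longleftrightarrow> set_adj (ones u) (ones v) \<or> set_adj (ones v) (ones u)"
    using uv by (simp only: unique_difference_iff)
  also have "\<dots> \<longleftrightarrow> set_adj (ones u) (ones v)"
    by (simp add: set_adj_def Un_commute)
  finally show ?thesis .
qed

text \<open>Through \<open>ones\<close> the cube becomes the family of independent sets of the graph
  \<open>R\<close>, where \<open>simplicial_aut_induced\<close> applies. The conclusion follows a
  letter to its new position: what stood at \<open>i\<close> in \<open>u\<close> stands at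
  \<open>\<pi> i\<close> in \<open>g u\<close>.\<close>

lemma independence_cube_aut:
  fixes R :: "nat \<Rightarrow> nat \<Rightarrow> bool"
  assumes W: "\<And>u. length u = n \<Longrightarrow> u \<in> W \<longleftrightarrow> (\<forall>i<n. \<forall>j<n. u ! i \<longrightarrow> u ! j \<longrightarrow> \<not> R i j)"
    and irrefl: "\<And>i. i < n \<Longrightarrow> \<not> R i i"
    and sym: "\<And>i j. R i j \<Longrightarrow> R j i"
    and no_isolated: "\<And>i. i < n \<Longrightarrow> \<exists>j<n. R i j"
    and g: "g \<in> ugraph_auts (cube n W)"
  shows "\<exists>\<pi>. inj_on \<pi> {..<n} \<and> \<pi> ` {..<n} \<subseteq> {..<n} \<and>
    (\<forall>i<n. \<forall>j<n. R i j \<longrightarrow> R (\<pi> i) (\<pi> j)) \<and>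
    (\<forall>u\<in>uverts (cube n W). \<forall>i<n. g u ! \<pi> i \<longleftrightarrow> u ! i)"
proof -
  let ?V = "uverts (cube n W)"
  define F where "F = {S. S \<subseteq> {..<n} \<and> (\<forall>i\<in>S. \<forall>j\<in>S. \<not> R i j)}"
  have onesF: "ones u \<in> F" if "u \<in> ?V" for u
    using that W[of u] by (auto simp: F_def ones_def uverts_cube)
  have bitsV: "bits n S \<in> ?V" if "S \<in> F" for S
    using that W[of "bits n S"] by (auto simp: F_def uverts_cube)
  have bij: "bij_betw g ?V ?V" using g by (simp add: ugraph_auts_def Bij_def)
  have gV: "g u \<in> ?V" if "u \<in> ?V" for u using bij_betwE[OF bij] that by blast
  define h where "h S = ones (g (bits n S))" for S
  have ob: "ones (bits n S) = S" if "S \<in> F" for S using that by (intro ones_bits) (simp add: F_def)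
  have bo: "bits n (ones u) = u" if "u \<in> ?V" for u using that bits_ones[of u] by (simp add: uverts_cube)
  have bij_ones: "bij_betw ones ?V F"
    by (rule bij_betw_byWitness[where f' = "bits n"]) (auto simp: ob bo onesF bitsV)
  have bij_bits: "bij_betw (bits n) F ?V"
    by (rule bij_betw_byWitness[where f' = ones]) (auto simp: ob bo onesF bitsV)
  have bij_h: "bij_betw h F F"
  proof -
    have "h = ones \<circ> (g \<circ> bits n)" by (simp add: fun_eq_iff h_def)
    then show ?thesis using bij_betw_trans[OF bij_betw_trans[OF bij_bits bij] bij_ones] by simp
  qed
  have adj: "set_adj (h S) (h T) \<longleftrightarrow> set_adj S T" if "S \<in> F" "T \<in> F" for S T
  proof -
    have "set_adj (h S) (h T) \<longleftrightarrow> {g (bits n S), g (bits n T)} \<in> uedges (cube n W)"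
      unfolding h_def by (rule edge_cube_iff[symmetric]) (intro gV bitsV that)+
    also have "\<dots> \<longleftrightarrow> {bits n S, bits n T} \<in> uedges (cube n W)"
      using g bitsV that by (simp add: ugraph_auts_def)
    also have "\<dots> \<longleftrightarrow> set_adj S T"
      using edge_cube_iff[OF bitsV bitsV] that by (simp add: ob)
    finally show ?thesis .
  qed
  have F_sub: "S \<subseteq> {..<n}" if "S \<in> F" for S using that by (simp add: F_def)
  have F_down: "T \<in> F" if "S \<in> F" "T \<subseteq> S" for S T using that by (auto simp: F_def)
  have F_empty: "{} \<in> F" by (simp add: F_def)
  have F_single: "{i} \<in> F" if "i \<in> {..<n}" for i using that irrefl by (auto simp: F_def)
  \<comment> \<open>A neighbour \<open>j\<close> of any element of \<open>S\<close> cannot be added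
    to \<open>S\<close>, and it lies outside \<open>S\<close> by independence.\<close>
  have F_no_cone: "\<exists>x\<in>{..<n} - S. insert x S \<notin> F" if S: "S \<in> F" "S \<noteq> {}" for S
  proof -
    obtain i where i: "i \<in> S" "i < n" using S(2) F_sub[OF S(1)] by blast
    then obtain j where "j < n" "R i j" using no_isolated by blast
    then show ?thesis using i S(1) by (intro bexI[of _ j]) (auto simp: F_def)
  qed
  have "\<exists>\<pi>. inj_on \<pi> {..<n} \<and> \<pi> ` {..<n} \<subseteq> {..<n} \<and> (\<forall>S\<in>F. h S = \<pi> ` S)"
    by (rule simplicial_aut_induced)
      (fact finite_lessThan F_sub F_down F_empty F_single F_no_cone bij_h adj)+
  then obtain \<pi> where inj: "inj_on \<pi> {..<n}" and range: "\<pi> ` {..<n} \<subseteq> {..<n}"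
    and "\<forall>S\<in>F. h S = \<pi> ` S"
    by (elim exE conjE)
  then have h\<pi>: "h S = \<pi> ` S" if "S \<in> F" for S using that by simp
  show ?thesis
  proof (intro exI[of _ \<pi>] conjI inj range allI impI ballI)
    fix i j assume ij: "i < n" "j < n" "R i j"
    show "R (\<pi> i) (\<pi> j)"
    proof (rule ccontr)
      assume neg: "\<not> R (\<pi> i) (\<pi> j)"
      have "\<pi> i < n" "\<pi> j < n" using range ij by auto
      \<comment> \<open>Being independent, this set is the image of some independent set, which by
        injectivity of \<open>\<pi>\<close> can only be \<open>{i, j}\<close>.\<close>
      then have "{\<pi> i, \<pi> j} \<in> F" using neg irrefl sym by (auto simp: F_def)
      then have "{\<pi> i, \<pi> j} \<in> h ` F" using bij_h by (simp add: bij_betw_imp_surj_on)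
      then obtain S where S: "S \<in> F" "\<pi> ` S = \<pi> ` {i, j}" using h\<pi> by force
      then have "S = {i, j}"
        using inj_on_image_eq_iff[OF inj, of S "{i, j}"] F_sub ij by simp
      then show False using S(1) ij(3) by (auto simp: F_def)
    qed
  next
    fix u i assume u: "u \<in> ?V" and i: "i < n"
    have "ones (g u) = \<pi> ` ones u" using h\<pi>[OF onesF[OF u]] by (simp add: h_def bo u)
    moreover have "\<pi> i \<in> \<pi> ` ones u \<longleftrightarrow> i \<in> ones u"
      using inj i F_sub[OF onesF[OF u]] by (simp add: inj_on_image_mem_iff)
    moreover have "\<pi> i < n" using range i by auto
    ultimately show "g u ! \<pi> i \<longleftrightarrow> u ! i"
      using u gV[OF u] i by (auto simp: ones_def uverts_cube)
  qed
qed

lemma set_adj_image: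
  assumes "inj_on p V" "A \<subseteq> V" "B \<subseteq> V"
  shows "set_adj (p ` A) (p ` B) \<longleftrightarrow> set_adj A B"
proof -
  have *: "sym_diff (p ` A) (p ` B) = p ` sym_diff A B"
    using inj_on_image_set_diff[OF assms(1), of A B] inj_on_image_set_diff[OF assms(1), of B A] assms
    by (auto simp: image_Un)
  have "card (p ` sym_diff A B) = card (sym_diff A B)"
    by (rule card_image) (use assms in \<open>auto intro: inj_on_subset\<close>)
  then show ?thesis by (simp add: set_adj_def * card_1_singleton_iff[symmetric] flip: One_nat_def)
qed

text \<open>The converse direction, supplying automorphisms. Note that \<open>p\<close> runs against
  \<open>f\<close>: it carries the ones of \<open>f u\<close> to those of \<open>u\<close>. Mapping
  \<open>W\<close> into itself suffices, because an injective self-map of the finite vertex set is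
  onto.\<close>

lemma coordinate_permutation_aut:
  assumes inj: "inj_on p {..<n}" and range: "p ` {..<n} \<subseteq> {..<n}"
    and len: "\<And>u. length u = n \<Longrightarrow> length (f u) = n"
    and nth: "\<And>u i. length u = n \<Longrightarrow> i < n \<Longrightarrow> f u ! i = u ! p i"
    and W: "\<And>u. length u = n \<Longrightarrow> u \<in> W \<Longrightarrow> f u \<in> W"
  shows "restrict f (uverts (cube n W)) \<in> ugraph_auts (cube n W)"
proof -
  let ?V = "uverts (cube n W)"
  have surj: "p ` {..<n} = {..<n}" using endo_inj_surj[OF _ range inj] by simp
  have ones: "ones u = p ` ones (f u)" if "length u = n" for u
  proof -
    have "ones u = {i \<in> p ` {..<n}. u ! i}" using that by (auto simp: ones_def surj)
    also have "\<dots> = p ` {i \<in> {..<n}. u ! p i}" by blast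
    also have "{i \<in> {..<n}. u ! p i} = ones (f u)" using that by (auto simp: ones_def len nth)
    finally show ?thesis .
  qed
  have fV: "f u \<in> ?V" if "u \<in> ?V" for u using that by (simp add: uverts_cube len W)
  have finj: "inj_on f ?V"
  proof (rule inj_onI)
    fix u v assume "u \<in> ?V" "v \<in> ?V" "f u = f v"
    then show "u = v" by (intro ones_inject) (auto simp: uverts_cube ones)
  qed
  have "finite ?V"
    by (rule finite_subset[OF _ finite_lists_length_eq[of "UNIV :: bool set" n]]) (auto simp: uverts_cube)
  then have "f ` ?V = ?V" by (rule endo_inj_surj) (use fV finj in auto)
  with finj have "restrict f ?V \<in> Bij ?V" by (simp add: Bij_def bij_betw_def)
  moreover have "{f u, f v} \<in> uedges (cube n W) \<longleftrightarrow> {u, v} \<in> uedges (cube n W)"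
    if "u \<in> ?V" "v \<in> ?V" for u v
  proof -
    have "length u = n" "length v = n" using that by (auto simp: uverts_cube)
    moreover have "ones (f u) \<subseteq> {..<n}" "ones (f v) \<subseteq> {..<n}"
      using ones_subset len calculation by metis+
    ultimately show ?thesis
      using that fV by (simp add: edge_cube_iff ones set_adj_image[OF inj])
  qed
  ultimately show ?thesis by (simp add: ugraph_auts_def)
qed

section \<open>Fibonacci strings up to reversal\<close>

text \<open>Burnside's count for a group of order two: a fixed point is a class by itself, and the
  remaining elements fall into disjoint pairs.\<close>

lemma card_involution_orbits:
  assumes fin: "finite A" and cl: "\<And>x. x \<in> A \<Longrightarrow> f x \<in> A" and inv: "\<And>x. x \<in> A \<Longrightarrow> f (f x) = x"
  shows "2 * card ((\<lambda>x. {x, f x}) ` A) = card A + card {x \<in> A. f x = x}"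
proof -
  let ?O = "\<lambda>x. {x, f x}"
  let ?B = "{x \<in> A. f x = x}" and ?C = "{x \<in> A. f x \<noteq> x}"
  have "card (?O ` ?B) = card ?B" by (rule card_image) (auto simp: inj_on_def)
  moreover have "2 * card (?O ` ?C) = card (\<Union> (?O ` ?C))"
  proof (rule card_partition)
    fix c1 c2 assume "c1 \<in> ?O ` ?C" "c2 \<in> ?O ` ?C" "c1 \<noteq> c2"
    then obtain x y where "x \<in> A" "y \<in> A" "c1 = {x, f x}" "c2 = {y, f y}" "c1 \<noteq> c2" by blast
    then show "c1 \<inter> c2 = {}" using inv[of x] inv[of y] by (metis disjoint_iff insert_commute insert_iff empty_iff)
  next
    fix c assume "c \<in> ?O ` ?C"
    then show "card c = 2" by (auto simp: card_2_iff)
  qed (use fin in simp_all)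
  moreover have "\<Union> (?O ` ?C) = ?C" using cl inv by auto
  moreover have "card (?O ` A) = card (?O ` ?B) + card (?O ` ?C)"
  proof -
    have "?O ` A = ?O ` ?B \<union> ?O ` ?C" by auto
    moreover have "card (?O ` ?B \<union> ?O ` ?C) = card (?O ` ?B) + card (?O ` ?C)"
    proof (rule card_Un_disjoint)
      show "?O ` ?B \<inter> ?O ` ?C = {}" by (auto simp: doubleton_eq_iff)
    qed (use fin in simp_all)
    ultimately show ?thesis by (simp only:)
  qed
  moreover have "card A = card ?B + card ?C"
  proof -
    have "card (?B \<union> ?C) = card ?B + card ?C"
      by (rule card_Un_disjoint) (use fin in \<open>simp_all add: disjoint_iff\<close>)
    moreover have "?B \<union> ?C = A" by blast
    ultimately show ?thesis by simp
  qed
  ultimately show ?thesis by simp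
qed

section \<open>Counting Fibonacci strings and palindromes\<close>

lemma fibonacci_string_successively:
  "fibonacci_string u \<longleftrightarrow> successively (\<lambda>a b. \<not> (a \<and> b)) u"
  by (simp add: fibonacci_string_def successively_conv_nth)

lemma fibonacci_string_rev [simp]: "fibonacci_string (rev u) \<longleftrightarrow> fibonacci_string u"
  unfolding fibonacci_string_successively successively_rev
  by (intro arg_cong2[where f = successively] refl) (auto simp: fun_eq_iff)

lemma fibonacci_string_simps [simp]:
  "fibonacci_string []"
  "fibonacci_string [a]"
  "fibonacci_string (False # u) \<longleftrightarrow> fibonacci_string u"
  "fibonacci_string (True # a # u) \<longleftrightarrow> \<not> a \<and> fibonacci_string (a # u)"
  by (auto simp: fibonacci_string_successively successively_Cons)

lemma fibonacci_string_append_False [simp]: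
  "fibonacci_string (u @ False # v) \<longleftrightarrow> fibonacci_string u \<and> fibonacci_string v"
  by (auto simp: fibonacci_string_successively successively_append_iff successively_Cons)

definition fibonacci_strings :: "nat \<Rightarrow> bool list set" where
  "fibonacci_strings m = {u. length u = m \<and> fibonacci_string u}"

lemma finite_fibonacci_strings [simp]: "finite (fibonacci_strings m)"
  unfolding fibonacci_strings_def
  by (rule finite_subset[OF _ finite_lists_length_eq[of "UNIV :: bool set" m]]) auto

lemma fibonacci_strings_Suc_Suc:
  "fibonacci_strings (Suc (Suc m)) =
    (#) False ` fibonacci_strings (Suc m) \<union> (\<lambda>u. True # False # u) ` fibonacci_strings m"
proof -
  have "u \<in> (#) False ` fibonacci_strings (Suc m) \<union> (\<lambda>u. True # False # u) ` fibonacci_strings m"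
    if u: "length u = Suc (Suc m)" "fibonacci_string u" for u
  proof -
    obtain a b v where "u = a # b # v" "length v = m" using u(1) by (auto simp: length_Suc_conv)
    then show ?thesis using u(2) by (cases a; cases b) (auto simp: fibonacci_strings_def)
  qed
  then show ?thesis by (fastforce simp: fibonacci_strings_def)
qed

lemma card_fibonacci_strings: "card (fibonacci_strings m) = fib (m + 2)"
proof (induction m rule: fib.induct)
  case 1
  have "fibonacci_strings 0 = {[]}" by (auto simp: fibonacci_strings_def)
  then show ?case by simp
next
  case 2
  have "fibonacci_strings (Suc 0) = {[False], [True]}"
    by (auto simp: fibonacci_strings_def length_Suc_conv)
  then show ?case by simp
next
  case (3 m)
  have "card ((#) False ` fibonacci_strings (Suc m) \<union> (\<lambda>u. True # False # u) ` fibonacci_strings m)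
      = card (fibonacci_strings (Suc m)) + card (fibonacci_strings m)"
    by (subst card_Un_disjoint) (auto simp: card_image inj_on_def)
  then show ?case using 3 by (simp add: fibonacci_strings_Suc_Suc)
qed

text \<open>The right half including the middle letter can be any Fibonacci string of length
  \<open>k + 1\<close>: mirroring its tail only repeats adjacencies that it already has.\<close>

lemma card_fibonacci_palindromes_odd:
  "card {u \<in> fibonacci_strings (2 * k + 1). rev u = u} = fib (k + 3)"
proof -
  have "bij_betw (\<lambda>x. rev (tl x) @ x) (fibonacci_strings (k + 1))
      {u \<in> fibonacci_strings (2 * k + 1). rev u = u}"
  proof (rule bij_betw_byWitness[where f' = "drop k"])
    show "\<forall>x\<in>fibonacci_strings (k + 1). drop k (rev (tl x) @ x) = x"
      by (simp add: fibonacci_strings_def)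
    have "rev (tl (drop k u)) @ drop k u = u" if u: "length u = 2 * k + 1" "rev u = u" for u :: "bool list"
    proof -
      have "rev (drop (Suc k) u) = take k (rev u)" using u(1) by (simp add: rev_drop)
      then show ?thesis using u(2) by (simp add: tl_drop drop_Suc[symmetric] flip: drop_Suc)
    qed
    then show "\<forall>u\<in>{u \<in> fibonacci_strings (2 * k + 1). rev u = u}. rev (tl (drop k u)) @ drop k u = u"
      by (simp add: fibonacci_strings_def)
    have "fibonacci_string (rev (tl x) @ x) \<and> rev (rev (tl x) @ x) = rev (tl x) @ x"
      if x: "length x = k + 1" "fibonacci_string x" for x
    proof -
      obtain a y where y: "x = a # y" using x(1) by (cases x) auto
      have "fibonacci_string (rev y @ [a])" using x(2) fibonacci_string_rev[of x] by (simp add: y)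
      then show ?thesis using x(2)
        by (auto simp: y fibonacci_string_successively successively_append_iff)
    qed
    then show "(\<lambda>x. rev (tl x) @ x) ` fibonacci_strings (k + 1)
        \<subseteq> {u \<in> fibonacci_strings (2 * k + 1). rev u = u}"
      by (auto simp: fibonacci_strings_def)
    have "fibonacci_string (drop k u)" if "fibonacci_string u" for u
      using that by (simp add: fibonacci_string_def)
    then show "drop k ` {u \<in> fibonacci_strings (2 * k + 1). rev u = u} \<subseteq> fibonacci_strings (k + 1)"
      by (auto simp: fibonacci_strings_def)
  qed
  from bij_betw_same_card[OF this] show ?thesis by (simp add: card_fibonacci_strings eval_nat_numeral)
qed

text \<open>The two middle letters are equal and adjacent, hence both 0, and the
  \<open>k - 1\<close> letters beyond them are a free Fibonacci string. The empty string has no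
  middle letters and is counted separately.\<close>

lemma card_fibonacci_palindromes_even:
  "card {u \<in> fibonacci_strings (2 * k). rev u = u} = fib (k + 1)"
proof (cases k)
  case 0
  have "{u \<in> fibonacci_strings 0. rev u = u} = {[]}" by (auto simp: fibonacci_strings_def)
  then show ?thesis by (simp add: 0)
next
  case (Suc j)
  have "bij_betw (\<lambda>x. rev x @ [False, False] @ x) (fibonacci_strings j)
      {u \<in> fibonacci_strings (2 * k). rev u = u}"
  proof (rule bij_betwI')
    fix x y :: "bool list" assume "x \<in> fibonacci_strings j" "y \<in> fibonacci_strings j"
    then show "rev x @ [False, False] @ x = rev y @ [False, False] @ y \<longleftrightarrow> x = y"
      by (auto simp: fibonacci_strings_def)
  next
    fix x assume "x \<in> fibonacci_strings j"
    then show "rev x @ [False, False] @ x \<in> {u \<in> fibonacci_strings (2 * k). rev u = u}"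
      by (simp add: fibonacci_strings_def Suc)
  next
    fix u assume "u \<in> {u \<in> fibonacci_strings (2 * k). rev u = u}"
    then have u: "length u = 2 * Suc j" "fibonacci_string u" "rev u = u"
      by (auto simp: fibonacci_strings_def Suc)
    obtain a x where drop: "drop (Suc j) u = a # x" "length x = j"
      using u(1) length_drop[of "Suc j" u] by (cases "drop (Suc j) u") auto
    have "take (Suc j) u = rev (drop (Suc j) u)"
      using u(1,3) rev_drop[of "Suc j" u] by simp
    then have ux: "u = rev x @ a # a # x"
      using append_take_drop_id[of "Suc j" u] by (simp add: drop)
    have "\<not> a" using u(2)
      by (auto simp: ux fibonacci_string_successively successively_append_iff)
    then have "x \<in> fibonacci_strings j" "u = rev x @ [False, False] @ x"
      using u(2) drop(2) by (simp_all add: ux fibonacci_strings_def)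
    then show "\<exists>x\<in>fibonacci_strings j. u = rev x @ [False, False] @ x" by blast
  qed
  from bij_betw_same_card[OF this] show ?thesis by (simp add: card_fibonacci_strings Suc)
qed

definition reversal_classes :: "nat \<Rightarrow> bool list set set" where
  "reversal_classes m = (\<lambda>u. {u, rev u}) ` fibonacci_strings m"

lemma card_reversal_classes:
  "2 * card (reversal_classes m) =
    fib (m + 2) + fib (if even m then m div 2 + 1 else m div 2 + 3)"
proof -
  have "2 * card (reversal_classes m) =
      card (fibonacci_strings m) + card {u \<in> fibonacci_strings m. rev u = u}"
    unfolding reversal_classes_def
    by (rule card_involution_orbits) (simp, auto simp: fibonacci_strings_def)
  moreover have "card {u \<in> fibonacci_strings m. rev u = u} =
      fib (if even m then m div 2 + 1 else m div 2 + 3)"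
  proof (cases "even m")
    case True
    then obtain k where "m = 2 * k" by (rule evenE)
    then show ?thesis using card_fibonacci_palindromes_even[of k] by simp
  next
    case False
    then obtain k where "m = 2 * k + 1" by (rule oddE)
    then show ?thesis using card_fibonacci_palindromes_odd[of k] by simp
  qed
  ultimately show ?thesis by (simp only: card_fibonacci_strings)
qed

section \<open>Vertex orbits of Fibonacci cubes\<close>

lemma carrier_ugraph_Aut [simp]: "carrier (ugraph_Aut G) = ugraph_auts G"
  by (simp add: ugraph_Aut_def)

lemma rev_in_cube_auts:
  assumes "\<And>u. u \<in> W \<Longrightarrow> rev u \<in> W"
  shows "restrict rev (uverts (cube n W)) \<in> ugraph_auts (cube n W)"
  by (rule coordinate_permutation_aut[where p = "\<lambda>i. n - Suc i"])
    (auto simp: inj_on_def rev_nth assms)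

lemma id_in_ugraph_auts: "(\<lambda>x\<in>uverts G. x) \<in> ugraph_auts G"
  by (auto simp: ugraph_auts_def id_Bij)

text \<open>For \<open>m \<ge> 2\<close> every position of the path has a neighbour; for
  \<open>m = 1\<close> the exchange of the two vertices would be a counterexample. The conclusion is
  pointwise, which is all that orbits require.\<close>

lemma fibonacci_cube_aut:
  assumes "m \<ge> 2" and g: "g \<in> ugraph_auts (fibonacci_cube m)" and u: "u \<in> fibonacci_strings m"
  shows "g u = u \<or> g u = rev u"
proof -
  let ?W = "{u. fibonacci_string u}"
  let ?R = "\<lambda>i j. j = Suc i \<or> i = Suc j"
  have V: "uverts (cube m ?W) = fibonacci_strings m"
    by (auto simp: uverts_cube fibonacci_strings_def)
  have gu: "length (g u) = m"
    using g u by (auto simp: fibonacci_cube_def ugraph_auts_def V Bij_def bij_betw_def fibonacci_strings_def)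
  have "\<exists>\<pi>. inj_on \<pi> {..<m} \<and> \<pi> ` {..<m} \<subseteq> {..<m} \<and>
    (\<forall>i<m. \<forall>j<m. ?R i j \<longrightarrow> ?R (\<pi> i) (\<pi> j)) \<and> (\<forall>u\<in>uverts (cube m ?W). \<forall>i<m. g u ! \<pi> i \<longleftrightarrow> u ! i)"
  proof (rule independence_cube_aut)
    show "\<exists>j<m. ?R i j" if "i < m" for i
    proof (cases i)
      case 0
      then show ?thesis using assms(1) by (intro exI[of _ 1]) auto
    next
      case (Suc j)
      then show ?thesis using that by (intro exI[of _ j]) auto
    qed
    show "u \<in> ?W \<longleftrightarrow> (\<forall>i<m. \<forall>j<m. u ! i \<longrightarrow> u ! j \<longrightarrow> \<not> ?R i j)" if "length u = m" for u
      using that by (auto simp: fibonacci_string_def) (metis Suc_lessD)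
    show "g \<in> ugraph_auts (cube m ?W)" using g by (simp add: fibonacci_cube_def)
  qed auto
  then obtain \<pi> where inj: "inj_on \<pi> {..<m}" and range: "\<pi> ` {..<m} \<subseteq> {..<m}"
    and R: "\<forall>i<m. \<forall>j<m. ?R i j \<longrightarrow> ?R (\<pi> i) (\<pi> j)" and "\<forall>u\<in>uverts (cube m ?W). \<forall>i<m. g u ! \<pi> i \<longleftrightarrow> u ! i"
    by (elim exE conjE)
  then have nth: "\<forall>i<m. g u ! \<pi> i \<longleftrightarrow> u ! i" using u V by blast
  have "(\<forall>i<m. \<pi> i = i) \<or> (\<forall>i<m. \<pi> i = m - 1 - i)"
    by (rule path_embedding[OF inj range]) (use R in auto)
  then show ?thesis
  proof
    assume "\<forall>i<m. \<pi> i = i"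
    then have "g u = u" using nth gu u by (intro nth_equalityI) (auto simp: fibonacci_strings_def)
    then show ?thesis ..
  next
    assume "\<forall>i<m. \<pi> i = m - 1 - i"
    then have "g u ! (m - 1 - i) = u ! i" if "i < m" for i using nth that by simp
    then have "rev (g u) = u"
      using gu u by (intro nth_equalityI) (auto simp: fibonacci_strings_def rev_nth)
    then show ?thesis by (metis rev_rev_ident)
  qed
qed

lemma o_V_fibonacci_cube:
  assumes "m \<ge> 2"
  shows "o_V (fibonacci_cube m) = card (reversal_classes m)"
proof -
  have V: "uverts (fibonacci_cube m) = fibonacci_strings m"
    by (auto simp: fibonacci_cube_def uverts_cube fibonacci_strings_def)
  have "orbit (ugraph_Aut (fibonacci_cube m)) (\<lambda>g. g) u = {u, rev u}"
    if u: "u \<in> fibonacci_strings m" for u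
  proof -
    let ?r = "restrict rev (fibonacci_strings m)" and ?i = "\<lambda>x\<in>fibonacci_strings m. x"
    have "?r \<in> ugraph_auts (fibonacci_cube m)"
      using rev_in_cube_auts[of "{u. fibonacci_string u}" m] V by (simp add: fibonacci_cube_def)
    moreover have "?i \<in> ugraph_auts (fibonacci_cube m)"
      using id_in_ugraph_auts[of "fibonacci_cube m"] V by simp
    moreover have "?r u = rev u" "?i u = u" using u by simp_all
    ultimately have "rev u \<in> orbit (ugraph_Aut (fibonacci_cube m)) (\<lambda>g. g) u"
      "u \<in> orbit (ugraph_Aut (fibonacci_cube m)) (\<lambda>g. g) u"
      unfolding orbit_def carrier_ugraph_Aut by (metis (mono_tags, lifting) mem_Collect_eq)+
    then show ?thesis
      using fibonacci_cube_aut[OF assms _ u] by (auto simp: orbit_def)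
  qed
  then have "vertex_orbits (fibonacci_cube m) = reversal_classes m"
    by (auto simp: vertex_orbits_def orbits_def reversal_classes_def V image_iff)
  then show ?thesis by (simp add: o_V_def)
qed

section \<open>Edge orbits of Lucas cubes\<close>

text \<open>This exhibits Lucas strings as independent sets of a cycle: the index
  \<open>n - 1\<close> gives the condition on first and last letter. For \<open>n = 1\<close> the
  single position is its own successor, which excludes the string 1 as the definition does.\<close>

lemma lucas_string_nth:
  assumes "length u = n" "n > 0"
  shows "lucas_string u \<longleftrightarrow> (\<forall>i<n. \<not> (u ! i \<and> u ! (Suc i mod n)))"
proof -
  have wrap: "\<not> (u \<noteq> [] \<and> hd u \<and> last u) \<longleftrightarrow> \<not> (u ! (n - 1) \<and> u ! (Suc (n - 1) mod n))"
    using assms by (auto simp: hd_conv_nth last_conv_nth)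
  have path: "fibonacci_string u \<longleftrightarrow> (\<forall>i<n. Suc i < n \<longrightarrow> \<not> (u ! i \<and> u ! (Suc i mod n)))"
    using assms by (auto simp: fibonacci_string_def)
  have "i = n - 1" if "i < n" "\<not> Suc i < n" for i using that by linarith
  then show ?thesis unfolding lucas_string_def wrap path using assms(2)
    by (metis diff_less zero_less_one)
qed

lemma lucas_string_rev: "lucas_string (rev u) \<longleftrightarrow> lucas_string u"
  by (auto simp: lucas_string_def hd_rev last_rev)

lemma lucas_string_rotate: "lucas_string u \<Longrightarrow> lucas_string (rotate k u)"
proof (induction k)
  case (Suc k)
  define v where "v = rotate k u"
  have "lucas_string v" using Suc by (simp add: v_def)
  then have "lucas_string (rotate1 v)"
    by (cases v) (auto simp: lucas_string_def fibonacci_string_successively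
        successively_append_iff successively_Cons hd_append split: if_splits)
  then show ?case by (simp add: v_def)
qed simp

lemma uverts_lucas_cube: "uverts (lucas_cube n) = {u. length u = n \<and> lucas_string u}"
  by (auto simp: lucas_cube_def uverts_cube)

lemma rotate_inverse:
  assumes "rotate k x = y"
  shows "x = rotate (length x - k mod length x) y"
proof (cases "x = []")
  case False
  then have "k mod length x < length x" by simp
  then have "(length x - k mod length x + k) mod length x = 0"
    by (metis add.commute le_add_diff_inverse2 less_imp_le mod_add_left_eq mod_self)
  then show ?thesis by (simp add: assms[symmetric] rotate_rotate)
qed (use assms in simp)

text \<open>The two cases of \<open>cycle_embedding\<close> are the rotations and the reflections of
  the cycle. Length at least 2 ensures that no position is its own cyclic successor.\<close>

lemma lucas_cube_aut:
  assumes "n \<ge> 2" and g: "g \<in> ugraph_auts (lucas_cube n)"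
  shows "\<exists>k. (\<forall>u\<in>uverts (lucas_cube n). g u = rotate k u) \<or>
    (\<forall>u\<in>uverts (lucas_cube n). g u = rotate k (rev u))"
proof -
  let ?W = "{u. lucas_string u}" and ?V = "uverts (lucas_cube n)"
  let ?R = "\<lambda>i j. j = Suc i mod n \<or> i = Suc j mod n"
  have V: "uverts (cube n ?W) = ?V" by (simp add: lucas_cube_def)
  have gV: "g u \<in> ?V" if "u \<in> ?V" for u
    using g that by (auto simp: ugraph_auts_def Bij_def bij_betw_def)
  have "\<exists>\<pi>. inj_on \<pi> {..<n} \<and> \<pi> ` {..<n} \<subseteq> {..<n} \<and>
    (\<forall>i<n. \<forall>j<n. ?R i j \<longrightarrow> ?R (\<pi> i) (\<pi> j)) \<and>
    (\<forall>u\<in>uverts (cube n ?W). \<forall>i<n. g u ! \<pi> i \<longleftrightarrow> u ! i)"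
  proof (rule independence_cube_aut)
    show "\<exists>j<n. ?R i j" if "i < n" for i
      using that by (intro exI[of _ "Suc i mod n"]) auto
    show "\<not> ?R i i" if "i < n" for i
      using that assms(1) by (auto simp: mod_Suc split: if_splits)
    show "u \<in> ?W \<longleftrightarrow> (\<forall>i<n. \<forall>j<n. u ! i \<longrightarrow> u ! j \<longrightarrow> \<not> ?R i j)" if "length u = n" for u
    proof -
      have "Suc i mod n < n" for i using assms(1) by simp
      moreover have "n > 0" using assms(1) by simp
      ultimately show ?thesis unfolding mem_Collect_eq lucas_string_nth[OF that \<open>n > 0\<close>] by blast
    qed
    show "g \<in> ugraph_auts (cube n ?W)" using g by (simp add: lucas_cube_def)
  qed auto
  then obtain \<pi> where inj: "inj_on \<pi> {..<n}" and range: "\<pi> ` {..<n} \<subseteq> {..<n}"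
    and R: "\<forall>i<n. \<forall>j<n. ?R i j \<longrightarrow> ?R (\<pi> i) (\<pi> j)"
    and "\<forall>u\<in>uverts (cube n ?W). \<forall>i<n. g u ! \<pi> i \<longleftrightarrow> u ! i"
    by (elim exE conjE)
  then have nth: "g u ! \<pi> i \<longleftrightarrow> u ! i" if "u \<in> ?V" "i < n" for u i
    using that V by blast
  have "(\<forall>i<n. \<pi> i = (\<pi> 0 + i) mod n) \<or> (\<forall>i<n. \<pi> i = (\<pi> 0 + (n - i)) mod n)"
  proof (rule cycle_embedding[OF inj range])
    fix i assume "Suc i < n"
    then show "\<pi> (Suc i) = Suc (\<pi> i) mod n \<or> \<pi> i = Suc (\<pi> (Suc i)) mod n"
      using R[rule_format, of i "Suc i"] by simp
  qed
  then show ?thesis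
  proof
    assume \<pi>: "\<forall>i<n. \<pi> i = (\<pi> 0 + i) mod n"
    have "g u = rotate (n - \<pi> 0 mod n) u" if u: "u \<in> ?V" for u
    proof -
      have len: "length u = n" "length (g u) = n" using u gV[OF u] by (auto simp: uverts_lucas_cube)
      \<comment> \<open>\<open>\<pi>\<close> moves letters to the right by \<open>\<pi> 0\<close>,
        whereas \<open>rotate\<close> moves them to the left, so \<open>g\<close> is undone first
        and the rotation inverted afterwards.\<close>
      have "rotate (\<pi> 0) (g u) = u"
      proof (rule nth_equalityI)
        fix i assume "i < length (rotate (\<pi> 0) (g u))"
        then have i: "i < n" by (simp add: len)
        then have "rotate (\<pi> 0) (g u) ! i = g u ! ((\<pi> 0 + i) mod n)" by (simp add: nth_rotate len)
        also have "(\<pi> 0 + i) mod n = \<pi> i" using \<pi> i by (metis)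
        finally show "rotate (\<pi> 0) (g u) ! i = u ! i" using nth[OF u i] by simp
      qed (simp add: len)
      then show ?thesis using rotate_inverse[of "\<pi> 0" "g u"] by (simp add: len)
    qed
    then show ?thesis by blast
  next
    assume \<pi>: "\<forall>i<n. \<pi> i = (\<pi> 0 + (n - i)) mod n"
    have "g u = rotate (n - Suc (\<pi> 0) mod n) (rev u)" if u: "u \<in> ?V" for u
    proof -
      have len: "length u = n" "length (g u) = n" using u gV[OF u] by (auto simp: uverts_lucas_cube)
      \<comment> \<open>\<open>rev\<close> exchanges \<open>i\<close> with \<open>n - 1 - i\<close>,
        while the reflection sends \<open>i\<close> to \<open>\<pi> 0 - i\<close> modulo
        \<open>n\<close>; the difference of one explains \<open>Suc\<close>.\<close>
      have "rotate (Suc (\<pi> 0)) (g u) = rev u"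
      proof (rule nth_equalityI)
        fix i assume "i < length (rotate (Suc (\<pi> 0)) (g u))"
        then have i: "i < n" by (simp add: len)
        then have "rotate (Suc (\<pi> 0)) (g u) ! i = g u ! ((Suc (\<pi> 0) + i) mod n)"
          by (subst nth_rotate) (simp_all only: len)
        also have "Suc (\<pi> 0) + i = \<pi> 0 + (n - (n - Suc i))" using i by simp
        also have "(\<pi> 0 + (n - (n - Suc i))) mod n = \<pi> (n - Suc i)"
          using \<pi> i by (metis diff_less zero_less_Suc order_le_less_trans zero_le)
        finally show "rotate (Suc (\<pi> 0)) (g u) ! i = rev u ! i"
          using nth[OF u, of "n - Suc i"] i by (simp add: rev_nth len)
      qed (simp add: len)
      then show ?thesis using rotate_inverse[of "Suc (\<pi> 0)" "g u"] by (simp only: len)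
    qed
    then show ?thesis by blast
  qed
qed

lemma rotate_in_lucas_cube_auts:
  "restrict (rotate k) (uverts (lucas_cube n)) \<in> ugraph_auts (lucas_cube n)"
  unfolding lucas_cube_def
proof (rule coordinate_permutation_aut[where p = "\<lambda>i. (k + i) mod n"])
  show "inj_on (\<lambda>i. (k + i) mod n) {..<n}"
  proof (rule inj_onI)
    fix i j assume "i \<in> {..<n}" "j \<in> {..<n}" "(k + i) mod n = (k + j) mod n"
    then show "i = j"
      using cong_add_lcancel_nat[of k i j n] by (simp add: cong_def)
  qed
qed (auto simp: nth_rotate lucas_string_rotate)

lemma rev_in_lucas_cube_auts:
  "restrict rev (uverts (lucas_cube n)) \<in> ugraph_auts (lucas_cube n)"
  unfolding lucas_cube_def by (rule rev_in_cube_auts) (simp add: lucas_string_rev)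

section \<open>Base edges as representatives of edge orbits\<close>

lemma (in group_action) orbit_image:
  assumes "x \<in> E" "g \<in> carrier G"
  shows "orbit G \<phi> (\<phi> g x) = orbit G \<phi> x"
proof -
  have y: "\<phi> g x \<in> E" "\<phi> g x \<in> orbit G \<phi> x"
    using element_image[OF assms(2,1)] assms by (auto simp: orbit_def)
  have sub: "orbit G \<phi> z \<subseteq> E" if "z \<in> E" for z
    using element_image that by (auto simp: orbit_def)
  show ?thesis
    using y orbit_sym[OF assms(1) y] orbit_trans[OF assms(1) y(1)] orbit_trans[OF y(1) assms(1)]
      sub[OF assms(1)] sub[OF y(1)] by blast
qed

abbreviation edge_orbit :: "nat \<Rightarrow> bool list set \<Rightarrow> bool list set set" where
  "edge_orbit n \<equiv> orbit (ugraph_Aut (lucas_cube n))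
    (\<lambda>g. \<lambda>e\<in>uedges (lucas_cube n). g ` e)"

lemma simple_lucas_cube: "simple_ugraph (lucas_cube n)"
  by (simp add: lucas_cube_def simple_induced simple_hypercube)

lemma edge_subset_uverts: "e \<in> uedges (lucas_cube n) \<Longrightarrow> e \<subseteq> uverts (lucas_cube n)"
  using simple_lucas_cube by (auto simp: simple_ugraph_def)

lemma edge_orbit_image:
  assumes e: "e \<in> uedges (lucas_cube n)"
    and f: "restrict f (uverts (lucas_cube n)) \<in> ugraph_auts (lucas_cube n)"
  shows "f ` e \<in> uedges (lucas_cube n)" "edge_orbit n (f ` e) = edge_orbit n e"
proof -
  interpret group_action "ugraph_Aut (lucas_cube n)" "uedges (lucas_cube n)"
    "\<lambda>g. \<lambda>e\<in>uedges (lucas_cube n). g ` e"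
    by (rule edge_group_action[OF simple_lucas_cube])
  let ?f = "restrict f (uverts (lucas_cube n))"
  have "?f ` e = f ` e" using edge_subset_uverts[OF e] by (auto intro!: image_cong)
  then have img: "(\<lambda>e\<in>uedges (lucas_cube n). ?f ` e) e = f ` e" using e by simp
  show "f ` e \<in> uedges (lucas_cube n)"
    using element_image[of ?f, OF _ e img] f by simp
  show "edge_orbit n (f ` e) = edge_orbit n e"
    using orbit_image[of e ?f, OF e] f img by simp
qed

text \<open>Every edge of a Lucas cube can be rotated so that it changes the first position; the
  neighbours of that position are then 0 and the remaining letters form a Fibonacci string.\<close>

definition base_edge :: "bool list \<Rightarrow> bool list set" where
  "base_edge w = {False # False # w @ [False], True # False # w @ [False]}"

lemma lucas_string_base:
  assumes "fibonacci_string w"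
  shows "lucas_string (b # False # w @ [False])"
proof -
  have "fibonacci_string ((False # w) @ False # [])"
    using assms by (simp only: fibonacci_string_append_False fibonacci_string_simps)
  then show ?thesis by (cases b) (simp_all add: lucas_string_def)
qed

lemma edge_lucas_cube_iff:
  "e \<in> uedges (lucas_cube n) \<longleftrightarrow> (\<exists>u v. e = {u, v} \<and> length u = n \<and> length v = n \<and>
    lucas_string u \<and> lucas_string v \<and> (\<exists>!i. i < n \<and> u ! i \<noteq> v ! i))"
proof -
  have "e \<in> {e \<in> {{u, v} | u v. length u = n \<and> length v = n \<and> P u v}. e \<subseteq> {u. lucas_string u}} \<longleftrightarrow>
    (\<exists>u v. e = {u, v} \<and> length u = n \<and> length v = n \<and> lucas_string u \<and> lucas_string v \<and> P u v)" for P
    by blast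
  then show ?thesis
    by (simp only: lucas_cube_def induced_ugraph_def hypercube_def ugraph.select_convs)
qed

lemma base_edge_in_uedges:
  assumes "w \<in> fibonacci_strings m"
  shows "base_edge w \<in> uedges (lucas_cube (m + 3))"
proof -
  let ?u = "\<lambda>b. b # False # w @ [False]"
  have ex1: "\<exists>!i. i < m + 3 \<and> ?u False ! i \<noteq> ?u True ! i"
    by (rule ex1I[of _ 0]) (auto simp: nth_Cons split: nat.splits)
  have len: "length (?u b) = m + 3" and luc: "lucas_string (?u b)" for b
    using assms lucas_string_base by (auto simp: fibonacci_strings_def)
  show ?thesis
    unfolding edge_lucas_cube_iff base_edge_def
    by (intro exI[of _ "?u False"] exI[of _ "?u True"] conjI refl ex1 len luc)
qed

text \<open>On the cycle the second and the last position are the neighbours of the first, so a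
  leading 1 forces both to be 0.\<close>

lemma lucas_string_True_Cons:
  assumes "lucas_string (True # t)" "length t = m + 2"
  shows "\<exists>w\<in>fibonacci_strings m. t = False # w @ [False]"
proof -
  obtain a s where s: "t = a # s" "length s = m + 1" using assms(2) by (cases t) auto
  obtain w b where w: "s = w @ [b]" "length w = m" using s(2) by (cases s rule: rev_cases) auto
  have "\<not> a" "\<not> b" using assms(1) by (auto simp: s w lucas_string_def)
  moreover from this have "fibonacci_string ((True # False # w) @ [False])"
    using assms(1) by (simp add: s w lucas_string_def)
  then have "fibonacci_string w" by (simp only: fibonacci_string_append_False) simp
  ultimately show ?thesis by (simp add: s w fibonacci_strings_def)
qed

lemma edge_rotates_to_base_edge:
  assumes e: "e \<in> uedges (lucas_cube (m + 3))"
  shows "\<exists>k. \<exists>w\<in>fibonacci_strings m. rotate k ` e = base_edge w"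
proof -
  let ?n = "m + 3"
  obtain u v where e_eq: "e = {u, v}" and len: "length u = ?n" "length v = ?n"
    and luc: "lucas_string u" "lucas_string v" and ex1: "\<exists>!i. i < ?n \<and> u ! i \<noteq> v ! i"
    using e unfolding edge_lucas_cube_iff by (elim exE conjE)
  from ex1 obtain i where i': "i < ?n \<and> u ! i \<noteq> v ! i"
    and uniq': "\<forall>j. j < ?n \<and> u ! j \<noteq> v ! j \<longrightarrow> j = i" by (rule ex1E)
  from i' have i: "i < ?n" "u ! i \<noteq> v ! i" by (rule conjunct1, rule conjunct2)
  have uniq: "j = i" if "j < ?n" "u ! j \<noteq> v ! j" for j using uniq' that by blast
  have same: "rotate i u ! j = rotate i v ! j" if "0 < j" "j < ?n" for j
  proof -
    have "(i + j) mod ?n \<noteq> i"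
    proof
      assume "(i + j) mod ?n = i"
      then have "[i + j = i + 0] (mod ?n)" using i(1) by (simp add: cong_def)
      then show False using that by (simp only: cong_add_lcancel_nat) (simp add: cong_def)
    qed
    then show ?thesis using uniq[of "(i + j) mod ?n"] that len by (auto simp: nth_rotate)
  qed
  obtain a s where s: "rotate i u = a # s" "length s = m + 2"
    using len length_rotate[of i u] by (cases "rotate i u") auto
  obtain b t where t: "rotate i v = b # t" "length t = m + 2"
    using len length_rotate[of i v] by (cases "rotate i v") auto
  have "rotate i u ! 0 \<noteq> rotate i v ! 0" using i len by (simp add: nth_rotate)
  then have "a \<noteq> b" by (simp add: s t)
  have "s = t"
  proof (rule nth_equalityI)
    show "s ! j = t ! j" if "j < length s" for j
      using same[of "Suc j"] that s t by simp
  qed (simp add: s t)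
  have "lucas_string (a # s)" "lucas_string (b # t)"
    using lucas_string_rotate[OF luc(1), of i] lucas_string_rotate[OF luc(2), of i]
    by (simp_all add: s t)
  \<comment> \<open>Exactly one end of the edge has a 1 at the changed position, and that end alone
    constrains the common tail.\<close>
  then have "lucas_string (True # s)" using \<open>s = t\<close> \<open>a \<noteq> b\<close> by (cases a) auto
  then obtain w where w: "w \<in> fibonacci_strings m" "s = False # w @ [False]"
    using lucas_string_True_Cons s(2) by blast
  have "rotate i ` e = {a # s, b # s}" by (simp add: e_eq s t \<open>s = t\<close>)
  also have "\<dots> = base_edge w" using \<open>a \<noteq> b\<close> by (cases a) (auto simp: base_edge_def w)
  finally show ?thesis using w(1) by blast
qed

text \<open>Reversal sends the changed letter from the front to the back, and one left rotation does
  the same. Together they give the reflection through the changed position, which identifies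
  \<open>w\<close> with \<open>rev w\<close>.\<close>

lemma rev_base_edge: "rev ` base_edge w = rotate1 ` base_edge (rev w)"
  by (simp add: base_edge_def)

text \<open>The ends of a base edge differ only at position 0, so a rotation between base edges must
  fix that position. Its amount is then a multiple of the length \<open>m + 3\<close>, and the
  rotation is the identity on these strings.\<close>

lemma rotate_base_edge_eq:
  assumes len: "length w = m" "length w' = m" and eq: "rotate k ` base_edge w = base_edge w'"
  shows "w = w'"
proof -
  let ?u = "\<lambda>b. b # False # w @ [False]"
  have nz: "?u False ! i = ?u True ! i" if "i > 0" for i using that by (cases i) auto
  have "rotate k (?u b) ! 0 = ?u b ! (k mod (m + 3))" for b
    using len nth_rotate[of 0 "?u b" k] by (simp add: add.commute)
  moreover have "rotate k (?u False) ! 0 \<noteq> rotate k (?u True) ! 0"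
  proof -
    have "{rotate k (?u False), rotate k (?u True)} =
        {False # False # w' @ [False], True # False # w' @ [False]}"
      using eq by (simp add: base_edge_def)
    then show ?thesis by (auto simp: doubleton_eq_iff)
  qed
  ultimately have "k mod (m + 3) = 0" using nz[of "k mod (m + 3)"] by fastforce
  then have "rotate k (?u b) = ?u b" for b using len by (intro rotate_id) (simp add: add.commute)
  then have "base_edge w = base_edge w'" using eq by (simp add: base_edge_def)
  then show ?thesis by (auto simp: base_edge_def doubleton_eq_iff)
qed

lemma edge_orbit_base_edge_rev:
  assumes "w \<in> fibonacci_strings m"
  shows "edge_orbit (m + 3) (base_edge (rev w)) = edge_orbit (m + 3) (base_edge w)"
proof -
  have w': "rev w \<in> fibonacci_strings m" using assms by (simp add: fibonacci_strings_def)
  have "edge_orbit (m + 3) (base_edge (rev w)) = edge_orbit (m + 3) (rotate1 ` base_edge (rev w))"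
    using edge_orbit_image(2)[OF base_edge_in_uedges[OF w'] rotate_in_lucas_cube_auts[of 1]]
    by simp
  also have "\<dots> = edge_orbit (m + 3) (base_edge w)"
    using edge_orbit_image(2)[OF base_edge_in_uedges[OF assms] rev_in_lucas_cube_auts]
    by (simp add: rev_base_edge)
  finally show ?thesis .
qed

text \<open>An automorphism joining the two edges is a rotation, possibly after a reversal. By
  \<open>rev_base_edge\<close> the reversal costs one more rotation and replaces \<open>w\<close> by
  \<open>rev w\<close>, so \<open>rotate_base_edge_eq\<close> settles both cases.\<close>

lemma edge_orbit_base_edge_eq:
  assumes w: "w \<in> fibonacci_strings m" and w': "w' \<in> fibonacci_strings m"
    and eq: "edge_orbit (m + 3) (base_edge w) = edge_orbit (m + 3) (base_edge w')"
  shows "w' = w \<or> w' = rev w"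
proof -
  let ?G = "lucas_cube (m + 3)"
  interpret group_action "ugraph_Aut ?G" "uedges ?G" "\<lambda>g. \<lambda>e\<in>uedges ?G. g ` e"
    by (rule edge_group_action[OF simple_lucas_cube])
  have len: "length w = m" "length w' = m" using w w' by (auto simp: fibonacci_strings_def)
  have "base_edge w' \<in> edge_orbit (m + 3) (base_edge w)"
    using orbit_refl[OF base_edge_in_uedges[OF w']] eq by simp
  then obtain g where g: "g \<in> ugraph_auts ?G" "base_edge w' = g ` base_edge w"
    using base_edge_in_uedges[OF w] by (auto simp: orbit_def)
  have sub: "base_edge w \<subseteq> uverts ?G" by (rule edge_subset_uverts[OF base_edge_in_uedges[OF w]])
  obtain k where "(\<forall>u\<in>uverts ?G. g u = rotate k u) \<or> (\<forall>u\<in>uverts ?G. g u = rotate k (rev u))"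
    using lucas_cube_aut[OF _ g(1)] by auto
  then show ?thesis
  proof
    assume "\<forall>u\<in>uverts ?G. g u = rotate k u"
    then have "g ` base_edge w = rotate k ` base_edge w" using sub by (intro image_cong) auto
    then show ?thesis using rotate_base_edge_eq[OF len] g(2) by metis
  next
    assume "\<forall>u\<in>uverts ?G. g u = rotate k (rev u)"
    then have "g ` base_edge w = (\<lambda>u. rotate k (rev u)) ` base_edge w"
      using sub by (intro image_cong) auto
    also have "\<dots> = rotate k ` rotate1 ` base_edge (rev w)"
      by (simp only: image_image[symmetric] rev_base_edge)
    also have "\<dots> = rotate (Suc k) ` base_edge (rev w)"
      by (simp add: image_image rotate1_rotate_swap)
    finally show ?thesis using rotate_base_edge_eq[of "rev w" m w' "Suc k"] len g(2) by simp
  qed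
qed

lemma o_E_lucas_cube: "o_E (lucas_cube (m + 3)) = card (reversal_classes m)"
proof -
  \<comment> \<open>The union avoids choosing a representative of the class: \<open>w\<close> and
    \<open>rev w\<close> contribute the same orbit.\<close>
  define F where "F c = (\<Union>w\<in>c. edge_orbit (m + 3) (base_edge w))" for c
  have F: "F {w, rev w} = edge_orbit (m + 3) (base_edge w)" if "w \<in> fibonacci_strings m" for w
    using edge_orbit_base_edge_rev[OF that] by (simp add: F_def)
  have "inj_on F (reversal_classes m)"
  proof (rule inj_onI)
    fix c d assume "c \<in> reversal_classes m" "d \<in> reversal_classes m" "F c = F d"
    then obtain w w' where w: "w \<in> fibonacci_strings m" "c = {w, rev w}"
      and w': "w' \<in> fibonacci_strings m" "d = {w', rev w'}" and "F c = F d"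
      by (auto simp: reversal_classes_def)
    then have "w' = w \<or> w' = rev w" by (intro edge_orbit_base_edge_eq) (simp_all add: F)
    then show "c = d" by (auto simp: w w')
  qed
  moreover have "F ` reversal_classes m = edge_orbits (lucas_cube (m + 3))"
  proof -
    have "F ` reversal_classes m = (\<lambda>w. edge_orbit (m + 3) (base_edge w)) ` fibonacci_strings m"
      unfolding reversal_classes_def image_image by (intro image_cong refl) (rule F)
    also have "\<dots> = edge_orbit (m + 3) ` uedges (lucas_cube (m + 3))"
    proof (intro equalityI subsetI)
      fix X assume "X \<in> edge_orbit (m + 3) ` uedges (lucas_cube (m + 3))"
      then obtain e where e: "e \<in> uedges (lucas_cube (m + 3))" "X = edge_orbit (m + 3) e" by blast
      obtain k w where w: "w \<in> fibonacci_strings m" "rotate k ` e = base_edge w"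
        using edge_rotates_to_base_edge[OF e(1)] by blast
      have "X = edge_orbit (m + 3) (base_edge w)"
        using edge_orbit_image(2)[OF e(1) rotate_in_lucas_cube_auts[of k]] w(2) e(2) by simp
      then show "X \<in> (\<lambda>w. edge_orbit (m + 3) (base_edge w)) ` fibonacci_strings m"
        using w(1) by blast
    qed (use base_edge_in_uedges in blast)
    also have "\<dots> = edge_orbits (lucas_cube (m + 3))"
      by (auto simp: edge_orbits_def orbits_def)
    finally show ?thesis .
  qed
  ultimately show ?thesis unfolding o_E_def by (metis card_image)
qed

section \<open>Lengths 1 and 2, too short for base edges\<close>

lemma o_E_lucas_cube_1: "o_E (lucas_cube 1) = 0"
proof -
  have lucas: "u = [False]" if "length u = 1" "lucas_string u" for u
    using that by (auto simp: lucas_string_def length_Suc_conv)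
  have "e \<notin> uedges (lucas_cube 1)" for e
  proof
    assume "e \<in> uedges (lucas_cube 1)"
    then obtain u v where e: "length u = 1" "length v = 1" "lucas_string u" "lucas_string v"
      and ex1: "\<exists>!i. i < 1 \<and> u ! i \<noteq> v ! i"
      unfolding edge_lucas_cube_iff by (elim exE conjE)
    have "u = v" using lucas e by metis
    then show False using ex1 by blast
  qed
  then have "uedges (lucas_cube 1) = {}" by blast
  then show ?thesis by (simp add: o_E_def edge_orbits_def orbits_def)
qed

text \<open>This cube is the path 10, 00, 01, and reversal exchanges its two edges.\<close>

lemma o_E_lucas_cube_2: "o_E (lucas_cube 2) = 1"
proof -
  let ?a = "{[False, False], [True, False]}" and ?b = "{[False, False], [False, True]}"
  have lucas: "u \<in> {[False, False], [True, False], [False, True]}" if "length u = 2" "lucas_string u" for u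
    using that by (auto simp: lucas_string_def length_Suc_conv numeral_2_eq_2)
  have edges: "e = ?a \<or> e = ?b" if e: "e \<in> uedges (lucas_cube 2)" for e
  proof -
    obtain u v where e: "e = {u, v}" "length u = 2" "length v = 2" "lucas_string u" "lucas_string v"
      and ex1: "\<exists>!i. i < 2 \<and> u ! i \<noteq> v ! i"
      using e unfolding edge_lucas_cube_iff by (elim exE conjE)
    from ex1 obtain i where i: "i < 2 \<and> u ! i \<noteq> v ! i"
      "\<forall>j. j < 2 \<and> u ! j \<noteq> v ! j \<longrightarrow> j = i" by (rule ex1E)
    \<comment> \<open>A pair differing at both positions, such as 10 and 01, is not an edge.\<close>
    have "\<not> (u ! 0 \<noteq> v ! 0 \<and> u ! 1 \<noteq> v ! 1)"
      using i(2)[rule_format, of 0] i(2)[rule_format, of 1] by auto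
    moreover have "u \<noteq> v" using i(1) by blast
    ultimately show ?thesis using lucas[OF e(2,4)] lucas[OF e(3,5)] by (auto simp: e)
  qed
  have a: "?a \<in> uedges (lucas_cube 2)"
  proof -
    have "\<exists>!i. i < 2 \<and> [False, False] ! i \<noteq> [True, False] ! i"
      by (rule ex1I[of _ 0]) (auto simp: less_2_cases_iff)
    moreover have "lucas_string [False, False]" "lucas_string [True, False]"
      by (simp_all add: lucas_string_def)
    ultimately show ?thesis unfolding edge_lucas_cube_iff
      by (intro exI[of _ "[False, False]"] exI[of _ "[True, False]"] conjI refl) simp_all
  qed
  have "edge_orbit 2 ?b = edge_orbit 2 ?a"
    using edge_orbit_image(2)[OF a rev_in_lucas_cube_auts] by simp
  then have "edge_orbits (lucas_cube 2) = {edge_orbit 2 ?a}"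
    using a edges by (auto simp: edge_orbits_def orbits_def)
  then show ?thesis by (simp add: o_E_def)
qed

theorem theorem5p9:
  shows "(\<forall>n::nat. n \<ge> 5 \<longrightarrow> o_E (lucas_cube n) = o_V (fibonacci_cube (n - 3))) \<and>
    (\<forall>n::nat. n \<ge> 1 \<longrightarrow>
       real (o_E (lucas_cube n)) =
         1 / 2 * (real (fib (n - 1)) + real (fib (nat \<lfloor>(real n + 1 + (-1) ^ n) / 2\<rfloor>))))"
proof (intro conjI allI impI)
  fix n :: nat assume "n \<ge> 5"
  then show "o_E (lucas_cube n) = o_V (fibonacci_cube (n - 3))"
    using o_E_lucas_cube[of "n - 3"] o_V_fibonacci_cube[of "n - 3"] by simp
next
  fix n :: nat assume "n \<ge> 1"
  have index: "nat \<lfloor>(real n + 1 + (-1) ^ n) / 2\<rfloor> = (if even n then n div 2 + 1 else n div 2)"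
  proof (cases "even n")
    case True
    then obtain k where k: "n = 2 * k" by (rule evenE)
    then have "(real n + 1 + (-1) ^ n) / 2 = real (k + 1)" by simp
    then show ?thesis by (simp only: floor_of_nat nat_int) (simp add: k)
  next
    case False
    then obtain k where k: "n = 2 * k + 1" by (rule oddE)
    then have "(real n + 1 + (-1) ^ n) / 2 = real k + 1 / 2" by simp
    moreover have "\<lfloor>real k + 1 / 2\<rfloor> = int k" by (simp add: floor_eq_iff)
    ultimately show ?thesis by (simp only: nat_int) (simp add: k)
  qed
  have "2 * o_E (lucas_cube n) = fib (n - 1) + fib (if even n then n div 2 + 1 else n div 2)"
  proof (cases "n \<ge> 3")
    case True
    then obtain m where n: "n = m + 3" by (metis add.commute le_Suc_ex)
    \<comment> \<open>Subtracting 3 switches the parity: for odd \<open>n\<close> the palindromes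
      have even length and \<open>m div 2 + 1\<close> is \<open>n div 2\<close>; for even
      \<open>n\<close> they have odd length and \<open>m div 2 + 3\<close> is
      \<open>n div 2 + 1\<close>.\<close>
    have "(if even m then m div 2 + 1 else m div 2 + 3) = (if even n then n div 2 + 1 else n div 2)"
      unfolding n by presburger
    then show ?thesis
      using card_reversal_classes[of m] by (simp add: n o_E_lucas_cube)
  next
    case False
    then consider "n = 1" | "n = 2" using \<open>n \<ge> 1\<close> by linarith
    then show ?thesis
      by cases (use o_E_lucas_cube_1 o_E_lucas_cube_2 in \<open>simp_all add: numeral_2_eq_2\<close>)
  qed
  then have "real (2 * o_E (lucas_cube n)) =
      real (fib (n - 1) + fib (if even n then n div 2 + 1 else n div 2))"
    by (simp only:)
  then show "real (o_E (lucas_cube n)) =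
      1 / 2 * (real (fib (n - 1)) + real (fib (nat \<lfloor>(real n + 1 + (-1) ^ n) / 2\<rfloor>)))"
    unfolding index by simp
qed

end
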